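(* For $g\ge2$, both $\mathfrak e_g^{(2c)}$ and $\mathfrak o_g^{(2c)}$ are polynomials of total degree $3g-2$ in $p$ and $c$ (i.e. given, for all primes $p\ge5$ and integers $0\le c\le(p-3)/2$, by polynomials in $p$ and $c$ with rational coefficients depending only on $g$). For $g\ge3$, the leading terms of these polynomials are given by $$\mathfrak e_g^{(2c)}\equiv\mathfrak o_g^{(2c)}\equiv\frac{(-1)^g}{4}\sum_{k=0}^{2g-2}\frac{B_k}{k!}\,\frac{c^{2g-2-k}}{(2g-2-k)!}\left(1+\frac{2c}{2g-1-k}\right)p^{g-1+k},$$ where $\equiv$ means equality up to addition of a polynomial in $p$ and $c$ of total degree $\le 3g-4$.
   Context: Bernoulli numbers are defined by $\frac{t}{e^t-1}=\sum_{n\ge0}B_n\frac{t^n}{n!}$ (so $B_1=-1/2$). Let $p\ge5$ be a prime, $d=(p-1)/2$, $0\le c\le d-1$. The lollipop tree $T_g^{(2c)}$ is the trivalent graph consisting of $g$ loops, the $i$-th loop attached to a stick edge, the sticks being attached successively to a spine ending in a free trunk edge colored $2c$. Its (small admissible) colorings are the families of integers $(a_1,\dots,a_g;\,l_1,\dots,l_g;\,k_0,\dots,k_g)$ (stick colors $2a_i$, loop colors $l_i$, spine colors $2k_i$) with $k_0=0$, $k_g=c$, such that for every $i=1,\dots,g$: $0\le a_i\le l_i\le d-1$, $|k_{i-1}-a_i|\le k_i\le k_{i-1}+a_i$, and $k_{i-1}+a_i+k_i\le 2d-1$ (with all $0\le k_i\le d-1$). (Here $k_1=a_1$: sticks 1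 and 2 meet at the first vertex; edges colored $0$ may be erased.) A coloring is even or odd according as $c+\sum_{i=1}^g a_i$ is even or odd. Let $\mathfrak e_g^{(2c)}$ and $\mathfrak o_g^{(2c)}$ be the numbers of even and odd colorings respectively (they depend on $p$). *)

theory Defs
  imports "HOL-Computational_Algebra.Computational_Algebra" "HOL-Library.FuncSet"
begin

section \<open>Bernoulli numbers\<close>

text \<open>
  Division of formal power series cancels the common power of the variable, so the quotient below
  is the genuine series $t/(e^t - 1)$; see the lemma following the definition.
\<close>

definition bernoulli :: "nat \<Rightarrow> rat" where
  "bernoulli n = fact n * fps_nth (fps_X / (fps_exp 1 - 1)) n"

lemma bernoulli_fps: "Abs_fps (\<lambda>n. bernoulli n / fact n) * (fps_exp 1 - 1) = fps_X"
proof -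
  have eq: "Abs_fps (\<lambda>n. bernoulli n / fact n) = fps_X / (fps_exp 1 - 1)"
    by (rule fps_ext) (simp add: bernoulli_def)
  have nz: "(fps_exp 1 - 1 :: rat fps) \<noteq> 0"
    by (auto simp: fps_eq_iff intro!: exI[of _ 1])
  have "subdegree (fps_exp 1 - 1 :: rat fps) = 1"
    by (rule subdegreeI) auto
  then have "(fps_exp 1 - 1 :: rat fps) dvd fps_X"
    using nz by (simp add: fps_dvd_iff)
  then show ?thesis
    unfolding eq by simp
qed


section \<open>Colorings of the lollipop tree\<close>

text \<open>
  A coloring is a triple \<open>(a, l, k)\<close>: stick \<open>i\<close> has color \<open>2 * a i\<close>, loop \<open>i\<close> has color \<open>l i\<close>
  and the \<open>i\<close>-th spine edge has color \<open>2 * k i\<close>.  The functions are extensional, so that a family of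
  integers indexed by \<open>{1..g}\<close> or \<open>{0..g}\<close> is counted exactly once.
\<close>

definition lollipop_colorings ::
    "nat \<Rightarrow> nat \<Rightarrow> nat \<Rightarrow> ((nat \<Rightarrow> int) \<times> (nat \<Rightarrow> int) \<times> (nat \<Rightarrow> int)) set" where
  "lollipop_colorings g p c =
    (let d = (int p - 1) div 2 in
      {(a, l, k).
         a \<in> extensional {1..g} \<and> l \<in> extensional {1..g} \<and> k \<in> extensional {0..g} \<and>
         k 0 = 0 \<and> k g = int c \<and>
         (\<forall>i\<in>{0..g}. 0 \<le> k i \<and> k i \<le> d - 1) \<and>
         (\<forall>i\<in>{1..g}.
            0 \<le> a i \<and> a i \<le> l i \<and> l i \<le> d - 1 \<and>
            \<bar>k (i - 1) - a i\<bar> \<le> k i \<and> k i \<le> k (i - 1) + a i \<and>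
            k (i - 1) + a i + k i \<le> 2 * d - 1)})"

definition num_even_colorings :: "nat \<Rightarrow> nat \<Rightarrow> nat \<Rightarrow> nat" where
  "num_even_colorings g p c =
     card {(a, l, k) \<in> lollipop_colorings g p c. even (int c + (\<Sum>i=1..g. a i))}"

definition num_odd_colorings :: "nat \<Rightarrow> nat \<Rightarrow> nat \<Rightarrow> nat" where
  "num_odd_colorings g p c =
     card {(a, l, k) \<in> lollipop_colorings g p c. odd (int c + (\<Sum>i=1..g. a i))}"


section \<open>Polynomials in two variables\<close>

text \<open>
  The ring $\mathbf{Q}[p, c]$ is represented as $\mathbf{Q}[c][p]$: the coefficient of
  $p^i c^j$ in \<open>P\<close> is \<open>coeff (coeff P i) j\<close>.
\<close>

type_synonym poly_pc = "rat poly poly"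

definition const_pc :: "rat \<Rightarrow> poly_pc" where
  "const_pc q = [:[:q:]:]"

definition var_p :: poly_pc where
  "var_p = [:0, 1:]"

definition var_c :: poly_pc where
  "var_c = [:[:0, 1:]:]"

definition eval_pc :: "poly_pc \<Rightarrow> rat \<Rightarrow> rat \<Rightarrow> rat" where
  "eval_pc P p c = poly (poly P [:p:]) c"

text \<open>As for univariate \<open>degree\<close>, the zero polynomial is given total degree \<open>0\<close>.\<close>

definition total_deg :: "poly_pc \<Rightarrow> nat" where
  "total_deg P = (if P = 0 then 0 else Max {i + j | i j. coeff (coeff P i) j \<noteq> 0})"

definition equiv_upto_deg :: "nat \<Rightarrow> poly_pc \<Rightarrow> poly_pc \<Rightarrow> bool" where
  "equiv_upto_deg n P Q \<longleftrightarrow> total_deg (P - Q) \<le> n"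

definition leading_terms :: "nat \<Rightarrow> poly_pc" where
  "leading_terms g =
     const_pc ((-1) ^ g / 4) *
     (\<Sum>k=0..2*g-2.
        const_pc (bernoulli k / fact k) *
        (const_pc (1 / fact (2*g-2-k)) * var_c ^ (2*g-2-k)) *
        (1 + const_pc (2 / of_nat (2*g-1-k)) * var_c) *
        var_p ^ (g-1+k))"

end

theory Submission
  imports Defs
begin

text \<open>
  Write $p = 2d + 1$ and $y = c + 1/2$, let $N_g(c)$ be the number of all colorings and $D_g(c)$
  the number of even ones minus the number of odd ones; then the two counts are
  $(N_g \pm D_g)/2$.

  Cutting off the last lollipop expresses both families through powers of a matrix indexed by the
  spine colors $0, \ldots, d-1$ (lemma \<open>weighted_count_Suc\<close>).  Summing out the loop and stick
  colors gives surprisingly simple entries: $(2\min(k,c)+1)(d-\max(k,c))$ for $N$ and, up to signs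
  that cancel in $D$, $d-\max(k,c)$ for $D$.  Each is a function of the minimum times a function of
  the maximum, both affine, that is, a Green's function of the second difference.  Hence
  \<open>F\<close> $= N_{g+1}$ is the solution of
  $F(c+1) - 2F(c) + F(c-1) = -p\,N_g(c)$ with $F(-1) = -F(0)$ and $F(d) = 0$,
  while $D_{g+1}$ solves the same equation with right-hand side $-D_g(c)$ and with
  $F(-1) = F(0)$, $F(d) = 0$.  These problems are uniquely solvable; in place of
  uniqueness the proof uses Green's formula (lemma \<open>green_formula\<close>).

  Solutions can be written down.  The central factorial polynomials
  $e_j(y) = \binom{y - 1/2 + j}{2j}$ and $o_j(y) = y\,e_j(y)/(2j+1)$ are discrete analogues of
  $y^{2j}/(2j)!$ and $y^{2j+1}/(2j+1)!$: the second difference lowers the index by one, and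
  they vanish at $y = \pm 1/2$ for $j > 0$.  So
  $$N_{n+1} = (-p)^n \Bigl(\sum_{j\le n} b_{n-j}\, o_j(y) + \frac p2\, e_n(y)\Bigr), \qquad
    D_{n+1} = (-1)^n \Bigl(\sum_{j\le n} a_{n-j}\, e_j(y) - o_n(y)\Bigr),$$
  where vanishing at $y = p/2$ is a convolution equation that determines $b$ and $a$ recursively
  as polynomials in $p$.

  For the degrees, $b_n$ has degree $2n$ and $a_n$ degree at most $2n+1$ in $p$, so $N_{n+1}$ has
  total degree $3n+1$ and $D_{n+1}$ at most $2n+1$; with $g = n+1$ the signed count is invisible
  modulo degree $3g-4$ as soon as $g \ge 3$.  Moreover $e_j$, $o_j$ and $b_n$ agree with their
  top homogeneous parts in $p$ and $y$ up to two degrees less.  On top parts the convolution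
  equation for $b$ says that $\sum_n b_n t^{2n}$ is $-\frac{pt}{2}\coth\frac{pt}{2}$, the even
  part of the generating function of the Bernoulli numbers up to sign, so the top
  part of $b_n$ is $-B_{2n}\,p^{2n}/(2n)!$.  Thus $N_g$ is
  $(-1)^g \sum_k \frac{B_k}{k!} \frac{y^{2g-1-k}}{(2g-1-k)!}\, p^{g-1+k}$ up to degree $3g-4$.
  Expanding $y = c + 1/2$ to second order turns $y^{m+1}/(m+1)!$ into
  $\frac12 \frac{c^m}{m!}\bigl(1 + \frac{2c}{m+1}\bigr)$, which is the shape of the stated
  leading terms.
\<close>

section \<open>The transfer matrix\<close>

text \<open>
  Every weight in use is multiplicative: the constant \<open>1\<close> counts all colorings, and the sign
  of the parity yields the difference of the even and the odd ones.
\<close>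

definition weighted_count :: "(int \<Rightarrow> rat) \<Rightarrow> nat \<Rightarrow> nat \<Rightarrow> nat \<Rightarrow> rat" where
  "weighted_count w g p c = (\<Sum>(a, l, k)\<in>lollipop_colorings g p c. w (\<Sum>i=1..g. a i))"

text \<open>
  The stick colors compatible with neighbouring spine colors \<open>k\<close> and \<open>c\<close>.  The two terms
  of the minimum add up to \<open>2 * d - 1\<close>, so the interval ends below \<open>d\<close>.
\<close>

definition stick_range :: "nat \<Rightarrow> int \<Rightarrow> int \<Rightarrow> int set" where
  "stick_range d k c = {\<bar>k - c\<bar>..min (k + c) (2 * int d - 1 - k - c)}"

text \<open>
  A stick of color \<open>a\<close> admits the \<open>d - a\<close> loop colors \<open>a, \<dots>, d - 1\<close>; this is the second factor.
\<close>

definition transfer :: "(int \<Rightarrow> rat) \<Rightarrow> nat \<Rightarrow> int \<Rightarrow> int \<Rightarrow> rat" where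
  "transfer w d k c = (\<Sum>a\<in>stick_range d k c. w a * of_int (int d - a))"

lemma mem_lollipop_colorings:
  "(a, l, k) \<in> lollipop_colorings g (Suc (2 * d)) c \<longleftrightarrow>
     a \<in> extensional {1..g} \<and> l \<in> extensional {1..g} \<and> k \<in> extensional {0..g} \<and>
     k 0 = 0 \<and> k g = int c \<and> (\<forall>i\<in>{0..g}. 0 \<le> k i \<and> k i \<le> int d - 1) \<and>
     (\<forall>i\<in>{1..g}. l i \<in> {a i..int d - 1} \<and> a i \<in> stick_range d (k (i - 1)) (k i))"
proof -
  have "(0 \<le> x \<and> x \<le> y \<and> y \<le> int d - 1 \<and> \<bar>s - x\<bar> \<le> t \<and> t \<le> s + x \<and> s + x + t \<le> 2 * int d - 1)
      \<longleftrightarrow> (y \<in> {x..int d - 1} \<and> x \<in> stick_range d s t)" for s t x y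
    by (auto simp: stick_range_def)
  moreover have "(int (Suc (2 * d)) - 1) div 2 = int d" by simp
  ultimately show ?thesis
    by (simp add: lollipop_colorings_def Let_def)
qed

lemma finite_lollipop_colorings: "finite (lollipop_colorings g (Suc (2 * d)) c)"
proof (rule finite_subset)
  let ?E = "\<lambda>I::nat set. PiE I (\<lambda>_. {0..int d})"
  show "lollipop_colorings g (Suc (2 * d)) c \<subseteq> ?E {1..g} \<times> ?E {1..g} \<times> ?E {0..g}"
  proof (rule subsetI)
    fix t assume t: "t \<in> lollipop_colorings g (Suc (2 * d)) c"
    obtain a l k where [simp]: "t = (a, l, k)" by (cases t)
    show "t \<in> ?E {1..g} \<times> ?E {1..g} \<times> ?E {0..g}"
      using t unfolding \<open>t = (a, l, k)\<close> mem_lollipop_colorings PiE_def Pi_def stick_range_def by force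
  qed
  show "finite (?E {1..g} \<times> ?E {1..g} \<times> ?E {0..g})"
    by (intro finite_cartesian_product finite_PiE) auto
qed

lemma weighted_count_0:
  assumes "d > 0" and "w 0 = 1"
  shows "weighted_count w 0 (Suc (2 * d)) c = (if c = 0 then 1 else 0)"
proof -
  have "lollipop_colorings 0 (Suc (2 * d)) c =
      (if c = 0 then {(\<lambda>_. undefined, \<lambda>_. undefined, (\<lambda>_. undefined)(0 := 0))} else {})"
  proof -
    have "x \<in> lollipop_colorings 0 (Suc (2 * d)) c \<longleftrightarrow>
      c = 0 \<and> x = (\<lambda>_. undefined, \<lambda>_. undefined, (\<lambda>_. undefined)(0 := 0))" for x
      using assms by (cases x) (auto simp: mem_lollipop_colorings extensional_def fun_eq_iff)
    then show ?thesis by auto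
  qed
  then show ?thesis using assms by (simp add: weighted_count_def)
qed

text \<open>
  A coloring of the longer tree is a coloring of the shorter one, whose trunk color \<open>k\<close> becomes
  an inner spine color, together with the colors of one more stick and loop.
\<close>

lemma weighted_count_Suc:
  assumes mult: "\<And>x y. w (x + y) = w x * w y" and c: "c < d"
  shows "weighted_count w (Suc g) (Suc (2 * d)) c =
    (\<Sum>k<d. weighted_count w g (Suc (2 * d)) k * transfer w d (int k) (int c))"
proof -
  let ?L = "\<lambda>g c. lollipop_colorings g (Suc (2 * d)) c"
  let ?S = "SIGMA k:{..<d}. SIGMA x:stick_range d (int k) (int c). {x..int d - 1}"
  let ?B = "SIGMA s:?S. ?L g (fst s)"
  have fin: "finite ?S" by (auto simp: stick_range_def)
  have "weighted_count w (Suc g) (Suc (2 * d)) c =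
    (\<Sum>((k', x, y), (a, l, k))\<in>?B. w (x + (\<Sum>i=1..g. a i)))"
    unfolding weighted_count_def
  proof (rule sum.reindex_bij_witness
      [where j = "\<lambda>(a, l, k). ((nat (k g), a (Suc g), l (Suc g)),
                   (restrict a {1..g}, restrict l {1..g}, restrict k {0..g}))"
         and i = "\<lambda>((k', x, y), (a, l, k)). (a(Suc g := x), l(Suc g := y), k(Suc g := int c))"],
     goal_cases)
    case (1 t)
    obtain a l k where t: "t = (a, l, k)" by (cases t)
    show ?case using 1 unfolding t mem_lollipop_colorings
      by (auto simp: fun_eq_iff extensional_def restrict_def)
  next
    case (2 t)
    obtain a l k where t: "t = (a, l, k)" by (cases t)
    have m: "(a, l, k) \<in> ?L (Suc g) c" using 2 t by simp
    note m' = m[unfolded mem_lollipop_colorings]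
    have kg: "0 \<le> k g" "k g \<le> int d - 1" using m' by auto
    have last: "l (Suc g) \<in> {a (Suc g)..int d - 1}" "a (Suc g) \<in> stick_range d (k g) (int c)"
      using m' by (auto dest: bspec[where x = "Suc g"])
    have "(restrict a {1..g}, restrict l {1..g}, restrict k {0..g}) \<in> ?L g (nat (k g))"
      unfolding mem_lollipop_colorings using m' kg by auto
    then show ?case using kg last unfolding t by auto
  next
    case (3 t)
    obtain k' x y a l k where t: "t = ((k', x, y), (a, l, k))" by (metis prod_cases3 surj_pair)
    show ?case using 3 unfolding t 
      by (auto simp: fun_eq_iff extensional_def restrict_def mem_lollipop_colorings)
  next
    case (4 t)
    obtain k' x y a l k where t: "t = ((k', x, y), (a, l, k))" by (metis prod_cases3 surj_pair)
    have m: "(a, l, k) \<in> ?L g k'" and s: "k' < d" "x \<in> stick_range d (int k') (int c)"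
       "y \<in> {x..int d - 1}" using 4 t by auto
    have "(a(Suc g := x), l(Suc g := y), k(Suc g := int c)) \<in> ?L (Suc g) c"
      unfolding mem_lollipop_colorings
    proof (intro conjI ballI, goal_cases)
      case (8 i) then show ?case using m c s unfolding mem_lollipop_colorings
        by (cases "i = Suc g") auto
    next
      case (9 i) then show ?case using m c s unfolding mem_lollipop_colorings
        by (cases "i = Suc g") auto
    qed (use m c in \<open>auto simp: mem_lollipop_colorings extensional_def\<close>)
    then show ?case unfolding t by simp
  next
    case (5 t)
    obtain a l k where t: "t = (a, l, k)" by (cases t)
    show ?case unfolding t by (simp add: add.commute)
  qed
  also have "\<dots> = (\<Sum>s\<in>?S. \<Sum>(a, l, k)\<in>?L g (fst s). w (fst (snd s)) * w (\<Sum>i=1..g. a i))"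
    by (subst sum.Sigma)
      (use fin in \<open>auto simp: mult finite_lollipop_colorings split_def\<close>)
  also have "\<dots> = (\<Sum>(k, x, y)\<in>?S. w x * weighted_count w g (Suc (2 * d)) k)"
    by (simp add: weighted_count_def sum_distrib_left split_def)
  also have "\<dots> = (\<Sum>k<d. \<Sum>x\<in>stick_range d (int k) (int c). \<Sum>y\<in>{x..int d - 1}.
                     w x * weighted_count w g (Suc (2 * d)) k)"
    by (subst sum.Sigma[symmetric]; (subst sum.Sigma[symmetric])?)
       (auto simp: stick_range_def)
  also have "\<dots> = (\<Sum>k<d. weighted_count w g (Suc (2 * d)) k * transfer w d (int k) (int c))"
    unfolding transfer_def sum_distrib_left
    by (intro sum.cong refl) (auto simp: stick_range_def of_nat_diff)
  finally show ?thesis .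
qed

lemma weighted_count_one:
  assumes mult: "\<And>x y. w (x + y) = w x * w y" and "w 0 = 1" and c: "c < d"
  shows "weighted_count w (Suc 0) (Suc (2 * d)) c = transfer w d 0 (int c)"
proof -
  have "weighted_count w (Suc 0) (Suc (2 * d)) c
    = (\<Sum>k<d. if k = 0 then transfer w d 0 (int c) else 0)"
    unfolding weighted_count_Suc[OF mult c]
    using c assms by (intro sum.cong) (auto simp: weighted_count_0)
  then show ?thesis using c by (simp add: sum.delta)
qed

section \<open>Entries of the transfer matrix\<close>

definition parity_sign :: "int \<Rightarrow> rat" where
  "parity_sign z = (if even z then 1 else -1)"

lemma parity_sign_add: "parity_sign (x + y) = parity_sign x * parity_sign y"
  by (auto simp: parity_sign_def)

lemma int_interval_Suc: "{m..<m + int (Suc n)} = insert (m + int n) {m..<m + int n}"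
  by auto

lemma sum_linear:
  "(\<Sum>a\<in>{m..<m + int n}. of_int (d - a) :: rat) = of_nat n * (of_int (2 * d - 2 * m) - of_nat n + 1) / 2"
proof (induction n)
  case (Suc n)
  then show ?case unfolding int_interval_Suc by (simp add: field_simps)
qed simp

text \<open>
  Consecutive terms cancel up to a sign: a pair contributes \<open>1\<close>, so \<open>n\<close> terms contribute
  \<open>n div 2\<close> when \<open>n\<close> is even, and one unpaired term remains when \<open>n\<close> is odd.
\<close>

lemma sum_alternating:
  "(\<Sum>a\<in>{m..<m + int n}. parity_sign a * of_int (d - a)) =
     parity_sign m * (if even n then of_nat n / 2 else of_int (d - m) - of_nat (n - 1) / 2)"
proof (induction n)
  case (Suc n)
  then show ?case unfolding int_interval_Suc
    by (auto simp: parity_sign_add parity_sign_def field_simps of_nat_diff elim!: oddE)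
qed simp

text \<open>
  The upper end of the interval is a minimum of two terms, and the two lengths that arise in this
  way have opposite parity.  The sums below turn out to have the same value for both
  lengths, which is why the transfer matrix has a uniform formula.
\<close>

lemma stick_range_cases:
  assumes "0 \<le> k" "k < int d" "0 \<le> c" "c < int d"
  obtains n where "stick_range d k c = {\<bar>k - c\<bar>..<\<bar>k - c\<bar> + int n}"
      and "int n = 2 * min k c + 1 \<or> int n = 2 * (int d - max k c)"
proof -
  define n where "n = nat (min (k + c) (2 * int d - 1 - k - c) + 1 - \<bar>k - c\<bar>)"
  show ?thesis
  proof (rule that)
    show "stick_range d k c = {\<bar>k - c\<bar>..<\<bar>k - c\<bar> + int n}"
      unfolding stick_range_def n_def by auto
    show "int n = 2 * min k c + 1 \<or> int n = 2 * (int d - max k c)"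
      unfolding n_def using assms by (auto simp: min_def max_def)
  qed
qed

text \<open>
  The interval has length $2\min(k,c)+1$ and mean value $\max(k,c)$, or length
  $2(d-\max(k,c))$ and such a mean that the average of \<open>d - a\<close> is $\min(k,c) + 1/2$; the
  product of length and average is the same.
\<close>

lemma transfer_one:
  assumes "0 \<le> k" "k < int d" "0 \<le> c" "c < int d"
  shows "transfer (\<lambda>_. 1) d k c = of_int ((2 * min k c + 1) * (int d - max k c))"
proof -
  obtain n where r: "stick_range d k c = {\<bar>k - c\<bar>..<\<bar>k - c\<bar> + int n}"
    and n: "int n = 2 * min k c + 1 \<or> int n = 2 * (int d - max k c)"
    using stick_range_cases[OF assms] .
  have m: "\<bar>k - c\<bar> = max k c - min k c" by auto
  have "transfer (\<lambda>_. 1) d k c = of_nat n * (of_int (2 * int d - 2 * \<bar>k - c\<bar>) - of_nat n + 1) / 2"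
    unfolding transfer_def r using sum_linear[of "int d" "\<bar>k - c\<bar>" n] by simp
  also have "\<dots> = of_int (int n) * (of_int (2 * int d - 2 * (max k c - min k c)) - of_int (int n) + 1) / 2"
    unfolding m by simp
  also have "\<dots> = of_int ((2 * min k c + 1) * (int d - max k c))"
    using n by (elim disjE; simp only:) (simp_all add: field_simps)
  finally show ?thesis .
qed

lemma transfer_parity_sign:
  assumes "0 \<le> k" "k < int d" "0 \<le> c" "c < int d"
  shows "transfer parity_sign d k c = parity_sign k * parity_sign c * of_int (int d - max k c)"
proof -
  obtain n where r: "stick_range d k c = {\<bar>k - c\<bar>..<\<bar>k - c\<bar> + int n}"
    and n: "int n = 2 * min k c + 1 \<or> int n = 2 * (int d - max k c)"
    using stick_range_cases[OF assms] .
  have m: "\<bar>k - c\<bar> = max k c - min k c" by auto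
  have s: "parity_sign \<bar>k - c\<bar> = parity_sign k * parity_sign c" by (auto simp: parity_sign_def)
  have "(if even n then of_nat n / 2 else of_int (int d - \<bar>k - c\<bar>) - of_nat (n - 1) / 2)
     = (of_int (int d - max k c) :: rat)"
    using n
  proof
    assume *: "int n = 2 * min k c + 1"
    then have "odd (int n)" by simp
    then have "odd n" by simp
    moreover have "n - 1 = 2 * nat (min k c)" using * assms by linarith
    ultimately show ?thesis using assms by (simp add: m)
  next
    assume *: "int n = 2 * (int d - max k c)"
    then have "even (int n)" by simp
    then have "even n" by simp
    moreover have "of_nat n = (of_int (int n) :: rat)" by simp
    ultimately show ?thesis using * by simp
  qed
  then show ?thesis
    unfolding transfer_def r sum_alternating s by simp
qed

section \<open>Green's formula for the second difference\<close>

text \<open>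
  Summation by parts: \<open>\<phi> \<cdot> \<Delta>\<^sup>2F - F \<cdot> \<Delta>\<^sup>2\<phi>\<close> is the difference of consecutive values of a discrete
  Wronskian, and the second product vanishes.
\<close>

lemma sum_second_difference:
  fixes \<phi> F :: "int \<Rightarrow> rat"
  assumes "\<And>z. \<phi> (z + 1) - 2 * \<phi> z + \<phi> (z - 1) = 0"
  shows "(\<Sum>k\<in>{m..<m + int n}. \<phi> k * (F (k + 1) - 2 * F k + F (k - 1))) =
    (\<phi> (m + int n - 1) * F (m + int n) - \<phi> (m + int n) * F (m + int n - 1)) -
    (\<phi> (m - 1) * F m - \<phi> m * F (m - 1))"
proof (induction n)
  case (Suc n)
  let ?z = "m + int n"
  have eq: "\<phi> (?z + 1) = 2 * \<phi> ?z - \<phi> (?z - 1)" using assms[of ?z] by simp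
  have e: "m + int (Suc n) = ?z + 1" "m + int (Suc n) - 1 = ?z" by simp_all
  have "(\<Sum>k\<in>{m..<m + int (Suc n)}. \<phi> k * (F (k + 1) - 2 * F k + F (k - 1))) =
      \<phi> ?z * (F (?z + 1) - 2 * F ?z + F (?z - 1)) +
      (\<Sum>k\<in>{m..<m + int n}. \<phi> k * (F (k + 1) - 2 * F k + F (k - 1)))"
    unfolding int_interval_Suc by (subst sum.insert) auto
  then show ?case unfolding e Suc eq by (simp add: algebra_simps)
qed simp

text \<open>
  With \<open>\<phi>\<close> adapted to the left and \<open>\<psi>\<close> to the right boundary condition, the kernel
  $\phi(\min)\,\psi(\max)$ inverts the second difference up to the Wronskian of \<open>\<phi>\<close> and \<open>\<psi>\<close>.  The
  sum is split at \<open>c\<close>, both parts are summed by parts, and only the boundary terms at \<open>c\<close> survive.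
\<close>

lemma green_formula:
  fixes \<phi> \<psi> F :: "int \<Rightarrow> rat"
  assumes phi: "\<And>z. \<phi> (z + 1) - 2 * \<phi> z + \<phi> (z - 1) = 0"
    and psi: "\<And>z. \<psi> (z + 1) - 2 * \<psi> z + \<psi> (z - 1) = 0"
    and left: "\<phi> (-1) * F 0 = \<phi> 0 * F (-1)"
    and right: "\<psi> (int d) = 0" "F (int d) = 0"
    and c: "0 \<le> c" "c < int d"
  shows "(\<Sum>k<d. (F (int k + 1) - 2 * F (int k) + F (int k - 1)) * (\<phi> (min (int k) c) * \<psi> (max (int k) c)))
       = - (\<phi> (c + 1) * \<psi> c - \<phi> c * \<psi> (c + 1)) * F c"
proof -
  let ?D = "\<lambda>k. F (k + 1) - 2 * F k + F (k - 1)"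
  have "(\<Sum>k<d. ?D (int k) * (\<phi> (min (int k) c) * \<psi> (max (int k) c)))
     = (\<Sum>k\<in>{0..<int d}. ?D k * (\<phi> (min k c) * \<psi> (max k c)))"
    by (rule sum.reindex_bij_witness[where i = nat and j = int]) auto
  also have "{0..<int d} = {0..<0 + int (nat (c + 1))} \<union> {c + 1..<c + 1 + int (nat (int d - c - 1))}"
    using c by auto
  also have "(\<Sum>k\<in>\<dots>. ?D k * (\<phi> (min k c) * \<psi> (max k c))) =
     (\<Sum>k\<in>{0..<0 + int (nat (c + 1))}. \<psi> c * (\<phi> k * ?D k)) +
     (\<Sum>k\<in>{c + 1..<c + 1 + int (nat (int d - c - 1))}. \<phi> c * (\<psi> k * ?D k))"
  proof (subst sum.union_disjoint)
    show "{0..<0 + int (nat (c + 1))} \<inter> {c + 1..<c + 1 + int (nat (int d - c - 1))} = {}"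
      using c by auto
  qed (auto intro!: arg_cong2[where f = "(+)"] sum.cong simp: min_def max_def)
  also have "\<dots> = \<psi> c * (\<phi> c * F (c + 1) - \<phi> (c + 1) * F c)
      - \<phi> c * (\<psi> c * F (c + 1) - \<psi> (c + 1) * F c)"
    unfolding sum_distrib_left[symmetric] sum_second_difference[OF phi] sum_second_difference[OF psi]
    using c left right by (simp add: algebra_simps)
  also have "\<dots> = - (\<phi> (c + 1) * \<psi> c - \<phi> c * \<psi> (c + 1)) * F c"
    by (simp add: algebra_simps)
  finally show ?thesis .
qed

section \<open>Evaluation of polynomials in $p$ and $c$\<close>

lemma eval_pc_simps [simp]:
  "eval_pc (P + Q) p c = eval_pc P p c + eval_pc Q p c"
  "eval_pc (P - Q) p c = eval_pc P p c - eval_pc Q p c"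
  "eval_pc (- P) p c = - eval_pc P p c"
  "eval_pc (P * Q) p c = eval_pc P p c * eval_pc Q p c"
  "eval_pc (P ^ n) p c = eval_pc P p c ^ n"
  "eval_pc 1 p c = 1"
  "eval_pc (const_pc q) p c = q"
  "eval_pc var_p p c = p"
  "eval_pc var_c p c = c"
  by (simp_all add: eval_pc_def const_pc_def var_p_def var_c_def)

lemma eval_pc_sum [simp]: "eval_pc (sum f A) p c = (\<Sum>x\<in>A. eval_pc (f x) p c)"
  by (simp add: eval_pc_def poly_sum)

lemma eval_pc_prod [simp]: "eval_pc (prod f A) p c = (\<Prod>x\<in>A. eval_pc (f x) p c)"
  by (simp add: eval_pc_def poly_prod)

section \<open>Convolution equations\<close>

text \<open>
  The unique sequence whose convolution with \<open>u\<close> is \<open>r\<close>, provided that \<open>u 0 = 1\<close>.  It is defined over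
  any commutative ring, so that the same recursion yields polynomials and their values.
\<close>

fun deconv :: "(nat \<Rightarrow> 'a::comm_ring_1) \<Rightarrow> (nat \<Rightarrow> 'a) \<Rightarrow> nat \<Rightarrow> 'a" where
  "deconv u r n = r n - (\<Sum>j=1..n. deconv u r (n - j) * u j)"

declare deconv.simps [simp del]

lemma deconv_0: "deconv u r 0 = r 0"
  by (subst deconv.simps) simp

lemma sum_deconv:
  assumes "u 0 = 1"
  shows "(\<Sum>j\<le>n. deconv u r (n - j) * u j) = r n"
proof -
  have "(\<Sum>j\<le>n. deconv u r (n - j) * u j) = deconv u r n + (\<Sum>j=1..n. deconv u r (n - j) * u j)"
    by (simp add: atMost_atLeast0 sum.atLeast_Suc_atMost assms)
  then show ?thesis by (simp add: deconv.simps[of u r n])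
qed

lemma eval_pc_deconv:
  "eval_pc (deconv u r n) p c = deconv (\<lambda>j. eval_pc (u j) p c) (\<lambda>j. eval_pc (r j) p c) n"
proof (induction n rule: less_induct)
  case (less n)
  then show ?case
    by (subst (1 2) deconv.simps) (auto intro!: sum.cong)
qed

section \<open>Central factorial polynomials\<close>

text \<open>
  The argument is left open because the polynomials are used both at $c + 1/2$ and at $p/2$.
  The product form displays the degree; the binomial form \<open>even_val\<close> of the values makes the second
  difference easy.
\<close>

definition central_even :: "nat \<Rightarrow> poly_pc \<Rightarrow> poly_pc" where
  "central_even j Y = const_pc (1 / fact (2 * j)) * (\<Prod>i<j. Y ^ 2 - const_pc ((of_nat i + 1/2) ^ 2))"

definition central_odd :: "nat \<Rightarrow> poly_pc \<Rightarrow> poly_pc" where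
  "central_odd j Y = const_pc (1 / of_nat (2 * j + 1)) * Y * central_even j Y"

definition even_val :: "nat \<Rightarrow> rat \<Rightarrow> rat" where
  "even_val j y = (y - 1/2 + of_nat j) gchoose (2 * j)"

definition odd_val :: "nat \<Rightarrow> rat \<Rightarrow> rat" where
  "odd_val j y = y * even_val j y / of_nat (2 * j + 1)"

lemma even_val_0 [simp]: "even_val 0 y = 1"
  by (simp add: even_val_def)

lemma odd_val_0 [simp]: "odd_val 0 y = y"
  by (simp add: odd_val_def)

lemma even_val_Suc:
  "even_val (Suc j) y = even_val j y * (y ^ 2 - (of_nat j + 1/2) ^ 2) / (of_nat (2 * j + 1) * of_nat (2 * j + 2))"
proof -
  define a where "a = y - 1/2 + of_nat j"
  have "even_val (Suc j) y = (a + 1) gchoose Suc (Suc (2 * j))"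
    unfolding even_val_def a_def by (simp add: algebra_simps)
  also have "\<dots> = (a + 1) / of_nat (Suc (Suc (2 * j))) * (a gchoose Suc (2 * j))"
    by (rule gbinomial_factors)
  also have "(a gchoose Suc (2 * j)) = (a - of_nat (2 * j)) / of_nat (Suc (2 * j)) * (a gchoose (2 * j))"
    using gbinomial_mult_1[of a "2 * j"] by (simp add: field_simps)
  also have "(a gchoose (2 * j)) = even_val j y"
    by (simp add: even_val_def a_def)
  finally show ?thesis
    unfolding a_def by (simp add: field_simps power2_eq_square)
qed

lemma eval_central_even: "eval_pc (central_even j Y) p c = even_val j (eval_pc Y p c)"
proof (induction j)
  case (Suc j)
  have "central_even (Suc j) Y = const_pc (1 / (of_nat (2 * j + 1) * of_nat (2 * j + 2)))
      * (Y ^ 2 - const_pc ((of_nat j + 1/2) ^ 2)) * central_even j Y"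
    unfolding central_even_def by (simp add: const_pc_def mult_ac)
  then show ?case using Suc by (simp add: even_val_Suc)
qed (simp add: central_even_def)

lemma eval_central_odd: "eval_pc (central_odd j Y) p c = odd_val j (eval_pc Y p c)"
  by (simp add: central_odd_def odd_val_def eval_central_even)

lemma gbinomial_second_difference:
  fixes a :: rat
  shows "((a + 1 + 1) gchoose Suc (Suc m)) - 2 * ((a + 1) gchoose Suc (Suc m)) + (a gchoose Suc (Suc m))
    = a gchoose m"
  unfolding gbinomial_Suc_Suc by simp

lemma even_val_second_difference:
  "even_val (Suc j) (y + 1) - 2 * even_val (Suc j) y + even_val (Suc j) (y - 1) = even_val j y"
  using gbinomial_second_difference[of "y - 1/2 + of_nat j" "2 * j"]
  by (simp add: even_val_def algebra_simps)

text \<open>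
  Up to a factor \<open>1/2\<close> the odd polynomial is a sum of two neighbouring binomial coefficients, to
  which Pascal's rule applies.
\<close>

lemma odd_val_altdef:
  "odd_val j y = (((y - 1/2 + of_nat j + 1) gchoose Suc (2 * j)) + ((y - 1/2 + of_nat j) gchoose Suc (2 * j))) / 2"
proof -
  define a where "a = y - 1/2 + of_nat j"
  define m :: rat where "m = of_nat (Suc (2 * j))"
  define t where "t = (a gchoose (2 * j))"
  have m: "m \<noteq> 0" unfolding m_def by (simp only: of_nat_eq_0_iff)
  have "((a + 1) gchoose Suc (2 * j)) = (a + 1) / m * t"
    unfolding m_def t_def by (rule gbinomial_factors)
  moreover have "(a gchoose Suc (2 * j)) = (a + 1 - m) / m * t"
    using gbinomial_mult_1[of a "2 * j"] m by (simp add: field_simps m_def t_def)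
  moreover have "y = (a + 1 + (a + 1 - m)) / 2"
    by (simp add: a_def m_def)
  moreover have "odd_val j y = y * t / m"
    by (simp add: odd_val_def even_val_def m_def t_def a_def)
  moreover have "(a + 1 + (a + 1 - m)) / 2 * t / m = ((a + 1) / m * t + (a + 1 - m) / m * t) / 2"
    using m by (simp add: field_simps)
  ultimately have "odd_val j y = ((a + 1) / m * t + (a + 1 - m) / m * t) / 2"
    by (simp only:)
  then show ?thesis
    unfolding a_def[symmetric]
    using \<open>((a + 1) gchoose Suc (2 * j)) = (a + 1) / m * t\<close>
      \<open>(a gchoose Suc (2 * j)) = (a + 1 - m) / m * t\<close> by simp
qed

lemma odd_val_second_difference:
  "odd_val (Suc j) (y + 1) - 2 * odd_val (Suc j) y + odd_val (Suc j) (y - 1) = odd_val j y"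
proof -
  define a where "a = y - 1/2 + of_nat j"
  let ?g = "\<lambda>x. x gchoose Suc (Suc (Suc (2 * j)))"
  have "odd_val (Suc j) (y + 1) = (?g (a + 1 + 1 + 1) + ?g (a + 1 + 1)) / 2"
    "odd_val (Suc j) y = (?g (a + 1 + 1) + ?g (a + 1)) / 2"
    "odd_val (Suc j) (y - 1) = (?g (a + 1) + ?g a) / 2"
    by (simp_all add: odd_val_altdef a_def algebra_simps)
  moreover have "odd_val j y = ((a + 1 gchoose Suc (2 * j)) + (a gchoose Suc (2 * j))) / 2"
    by (simp add: odd_val_altdef a_def)
  ultimately show ?thesis
    using gbinomial_second_difference[of a "Suc (2 * j)"]
      gbinomial_second_difference[of "a + 1" "Suc (2 * j)"]
    by (simp add: field_simps)
qed

lemma even_val_half: "even_val j (1/2) = (if j = 0 then 1 else 0)"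
  using gbinomial_binomial[of j "2 * j"] binomial_eq_0[of j "2 * j"]
  by (auto simp: even_val_def binomial_gbinomial[symmetric])

lemma even_val_minus_half: "even_val j (- (1/2)) = (if j = 0 then 1 else 0)"
proof (cases j)
  case (Suc i)
  have "even_val j (- (1/2)) = of_nat i gchoose (2 * j)"
    unfolding even_val_def using Suc by (intro arg_cong2[where f = "(gchoose)"]) simp_all
  then show ?thesis using Suc by (simp add: binomial_gbinomial[symmetric])
qed simp

lemma odd_val_half: "odd_val j (1/2) = (if j = 0 then 1/2 else 0)"
  by (simp add: odd_val_def even_val_half)

lemma odd_val_minus_half: "odd_val j (- (1/2)) = (if j = 0 then - (1/2) else 0)"
  by (simp add: odd_val_def even_val_minus_half)

section \<open>Explicit solutions of the two boundary value problems\<close>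

text \<open>
  Common shape of the solutions: the \<open>A\<close> family absorbs the homogeneous solutions added at each
  step, the \<open>B\<close> family propagates the part of the initial function of the other parity.
\<close>

definition ladder ::
  "(nat \<Rightarrow> rat) \<Rightarrow> (nat \<Rightarrow> rat \<Rightarrow> rat) \<Rightarrow> rat \<Rightarrow> (nat \<Rightarrow> rat \<Rightarrow> rat) \<Rightarrow> nat \<Rightarrow> rat \<Rightarrow> rat" where
  "ladder b A v B n y = (\<Sum>j\<le>n. b (n - j) * A j y) + v * B n y"

lemma ladder_second_difference:
  assumes A0: "\<And>y. A 0 (y + 1) - 2 * A 0 y + A 0 (y - 1) = 0"
    and A: "\<And>j y. A (Suc j) (y + 1) - 2 * A (Suc j) y + A (Suc j) (y - 1) = A j y"
    and B: "\<And>j y. B (Suc j) (y + 1) - 2 * B (Suc j) y + B (Suc j) (y - 1) = B j y"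
  shows "ladder b A v B (Suc n) (y + 1) - 2 * ladder b A v B (Suc n) y + ladder b A v B (Suc n) (y - 1)
    = ladder b A v B n y"
proof -
  have "ladder b A v B (Suc n) (y + 1) - 2 * ladder b A v B (Suc n) y + ladder b A v B (Suc n) (y - 1)
    = (\<Sum>j\<le>Suc n. b (Suc n - j) * (A j (y + 1) - 2 * A j y + A j (y - 1)))
      + v * (B (Suc n) (y + 1) - 2 * B (Suc n) y + B (Suc n) (y - 1))"
    unfolding ladder_def by (simp add: algebra_simps sum.distrib sum_subtractf sum_distrib_left)
  also have "\<dots> = (\<Sum>j\<le>n. b (n - j) * A j y) + v * B n y"
    by (simp only: sum.atMost_Suc_shift A0 A B) simp
  finally show ?thesis by (simp add: ladder_def)
qed

text \<open>
  The equation behind these coefficients is the vanishing of the ladder at the right end $y = p/2$,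
  divided by the common factor \<open>p/2\<close> of all odd central factorials there.
\<close>

definition plain_coeff :: "rat \<Rightarrow> nat \<Rightarrow> rat" where
  "plain_coeff p = deconv (\<lambda>j. even_val j (p/2) / of_nat (2 * j + 1)) (\<lambda>j. - even_val j (p/2))"

definition signed_coeff :: "rat \<Rightarrow> nat \<Rightarrow> rat" where
  "signed_coeff p = deconv (\<lambda>j. even_val j (p/2)) (\<lambda>j. odd_val j (p/2))"

definition plain_val :: "rat \<Rightarrow> nat \<Rightarrow> rat \<Rightarrow> rat" where
  "plain_val p n y = (- p) ^ n * ladder (plain_coeff p) odd_val (p/2) even_val n y"

definition signed_val :: "rat \<Rightarrow> nat \<Rightarrow> rat \<Rightarrow> rat" where
  "signed_val p n y = (- 1) ^ n * ladder (signed_coeff p) even_val (-1) odd_val n y"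

lemma plain_val_right: "plain_val p n (p/2) = 0"
proof -
  have "(\<Sum>j\<le>n. plain_coeff p (n - j) * (even_val j (p/2) / of_nat (2 * j + 1))) = - even_val n (p/2)"
    unfolding plain_coeff_def by (rule sum_deconv) simp
  then have "p/2 * (\<Sum>j\<le>n. plain_coeff p (n - j) * (even_val j (p/2) / of_nat (2 * j + 1)))
      + p/2 * even_val n (p/2) = 0" by simp
  then have "ladder (plain_coeff p) odd_val (p/2) even_val n (p/2) = 0"
    unfolding ladder_def odd_val_def sum_distrib_left by (simp add: mult_ac)
  then show ?thesis by (simp add: plain_val_def)
qed

lemma signed_val_right: "signed_val p n (p/2) = 0"
  unfolding signed_val_def ladder_def signed_coeff_def
  by (subst sum_deconv) auto

lemma sum_only_0: "(\<Sum>j\<le>n. f j * (if j = 0 then x else 0)) = f (0::nat) * (x::rat)"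
  by (induction n) auto

text \<open>
  All terms of index \<open>j > 0\<close> vanish at $y = \pm 1/2$; only $o_0(y) = y$ contributes.
\<close>

lemma plain_val_left: "plain_val p (Suc n) (- (1/2)) = - plain_val p (Suc n) (1/2)"
  unfolding plain_val_def ladder_def even_val_half even_val_minus_half odd_val_half
    odd_val_minus_half sum_only_0 by simp

lemma signed_val_left: "signed_val p (Suc n) (- (1/2)) = signed_val p (Suc n) (1/2)"
  unfolding signed_val_def ladder_def even_val_half even_val_minus_half odd_val_half
    odd_val_minus_half sum_only_0 by simp

lemma plain_val_second_difference:
  "plain_val p (Suc n) (y + 1) - 2 * plain_val p (Suc n) y + plain_val p (Suc n) (y - 1)
    = - p * plain_val p n y"
proof -
  let ?l = "ladder (plain_coeff p) odd_val (p/2) even_val"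
  have "plain_val p (Suc n) (y + 1) - 2 * plain_val p (Suc n) y + plain_val p (Suc n) (y - 1)
    = (- p) ^ Suc n * (?l (Suc n) (y + 1) - 2 * ?l (Suc n) y + ?l (Suc n) (y - 1))"
    unfolding plain_val_def by (simp add: algebra_simps)
  also have "?l (Suc n) (y + 1) - 2 * ?l (Suc n) y + ?l (Suc n) (y - 1) = ?l n y"
    by (rule ladder_second_difference)
      (simp_all add: even_val_second_difference odd_val_second_difference)
  finally show ?thesis by (simp add: plain_val_def)
qed

lemma signed_val_second_difference:
  "signed_val p (Suc n) (y + 1) - 2 * signed_val p (Suc n) y + signed_val p (Suc n) (y - 1) = - signed_val p n y"
proof -
  let ?l = "ladder (signed_coeff p) even_val (-1) odd_val"
  have "signed_val p (Suc n) (y + 1) - 2 * signed_val p (Suc n) y + signed_val p (Suc n) (y - 1)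
    = (- 1) ^ Suc n * (?l (Suc n) (y + 1) - 2 * ?l (Suc n) y + ?l (Suc n) (y - 1))"
    unfolding signed_val_def by (simp add: algebra_simps)
  also have "?l (Suc n) (y + 1) - 2 * ?l (Suc n) y + ?l (Suc n) (y - 1) = ?l n y"
    by (rule ladder_second_difference)
      (simp_all add: even_val_second_difference odd_val_second_difference)
  finally show ?thesis by (simp add: signed_val_def)
qed

section \<open>The counts are values of the explicit solutions\<close>

text \<open>
  The value satisfies the difference equation and both boundary conditions, so Green's formula
  recovers it from its predecessor by exactly the transfer matrix.  The Wronskian of \<open>2 * z + 1\<close>
  and \<open>d - z\<close> is \<open>p\<close>, which cancels the factor \<open>p\<close> of the difference equation.
\<close>

lemma plain_count_eq:
  "c < d \<Longrightarrow> weighted_count (\<lambda>_. 1) (Suc n) (Suc (2 * d)) c = plain_val (of_nat (2 * d + 1)) n (of_nat c + 1/2)"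
proof (induction n arbitrary: c)
  case 0
  then show ?case
    by (subst weighted_count_one)
      (auto simp: transfer_one plain_val_def ladder_def plain_coeff_def deconv_0 field_simps)
next
  case (Suc n)
  let ?p = "of_nat (2 * d + 1) :: rat"
  let ?phi = "\<lambda>z. of_int (2 * z + 1) :: rat" and ?psi = "\<lambda>z. of_int (int d - z) :: rat"
  let ?F = "\<lambda>z. plain_val ?p (Suc n) (of_int z + 1/2)"
  have diff: "?F (z + 1) - 2 * ?F z + ?F (z - 1) = - ?p * plain_val ?p n (of_int z + 1/2)" for z
    using plain_val_second_difference[of ?p n "of_int z + 1/2"] by (simp add: algebra_simps)
  have end_pt: "of_int (int d) + 1/2 = ?p / 2" by (simp add: field_simps)
  have "- ?p * weighted_count (\<lambda>_. 1) (Suc (Suc n)) (Suc (2 * d)) c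
    = - ?p * (\<Sum>k<d. plain_val ?p n (of_nat k + 1/2) * (?phi (min (int k) (int c)) * ?psi (max (int k) (int c))))"
    using Suc.prems by (subst weighted_count_Suc) (simp_all add: Suc.IH transfer_one)
  also have "\<dots> = (\<Sum>k<d. (?F (int k + 1) - 2 * ?F (int k) + ?F (int k - 1)) *
      (?phi (min (int k) (int c)) * ?psi (max (int k) (int c))))"
    unfolding diff by (simp add: sum_distrib_left mult_ac)
  also have "\<dots> = - (?phi (int c + 1) * ?psi (int c) - ?phi (int c) * ?psi (int c + 1)) * ?F (int c)"
  proof (rule green_formula)
    show "?phi (-1) * ?F 0 = ?phi 0 * ?F (-1)" using plain_val_left[of ?p n] by simp
    show "?F (int d) = 0" unfolding end_pt by (rule plain_val_right)
  qed (use Suc.prems in \<open>auto simp: algebra_simps\<close>)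
  also have "?phi (int c + 1) * ?psi (int c) - ?phi (int c) * ?psi (int c + 1) = ?p"
    by (simp add: algebra_simps)
  finally have "?p * weighted_count (\<lambda>_. 1) (Suc (Suc n)) (Suc (2 * d)) c = ?p * ?F (int c)"
    by simp
  moreover have "?p \<noteq> 0" by (simp only: of_nat_eq_0_iff)
  ultimately show ?case by simp
qed

text \<open>
  The same argument with the constant function \<open>1\<close> on the left; now the Wronskian is \<open>1\<close>.  The signs in
  the transfer matrix conjugate it by a diagonal matrix, hence the factor \<open>parity_sign (int c)\<close>.
\<close>

lemma signed_count_eq:
  "c < d \<Longrightarrow> weighted_count parity_sign (Suc n) (Suc (2 * d)) c = parity_sign (int c) * signed_val (of_nat (2 * d + 1)) n (of_nat c + 1/2)"
proof (induction n arbitrary: c)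
  case 0
  then show ?case
    by (subst weighted_count_one)
      (auto simp: parity_sign_add transfer_parity_sign signed_val_def ladder_def signed_coeff_def deconv_0 field_simps
        parity_sign_def)
next
  case (Suc n)
  have sq: "parity_sign z * (parity_sign z * x) = x" for z x by (simp add: parity_sign_def)
  let ?p = "of_nat (2 * d + 1) :: rat"
  let ?phi = "\<lambda>z::int. 1 :: rat" and ?psi = "\<lambda>z. of_int (int d - z) :: rat"
  let ?F = "\<lambda>z. signed_val ?p (Suc n) (of_int z + 1/2)"
  have diff: "?F (z + 1) - 2 * ?F z + ?F (z - 1) = - signed_val ?p n (of_int z + 1/2)" for z
    using signed_val_second_difference[of ?p n "of_int z + 1/2"] by (simp add: algebra_simps)
  have end_pt: "of_int (int d) + 1/2 = ?p / 2" by (simp add: field_simps)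
  have "weighted_count parity_sign (Suc (Suc n)) (Suc (2 * d)) c
    = (\<Sum>k<d. parity_sign (int k) * signed_val ?p n (of_nat k + 1/2) *
        (parity_sign (int k) * parity_sign (int c) * ?psi (max (int k) (int c))))"
    using Suc.prems by (subst weighted_count_Suc) (simp_all add: Suc.IH transfer_parity_sign parity_sign_add)
  also have "\<dots> = - parity_sign (int c) * (\<Sum>k<d. (?F (int k + 1) - 2 * ?F (int k) + ?F (int k - 1)) *
      (?phi (min (int k) (int c)) * ?psi (max (int k) (int c))))"
    unfolding diff sum_distrib_left by (intro sum.cong) (simp_all add: mult_ac sq)
  also have "(\<Sum>k<d. (?F (int k + 1) - 2 * ?F (int k) + ?F (int k - 1)) *
      (?phi (min (int k) (int c)) * ?psi (max (int k) (int c))))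
    = - (?phi (int c + 1) * ?psi (int c) - ?phi (int c) * ?psi (int c + 1)) * ?F (int c)"
  proof (rule green_formula)
    show "?phi (-1) * ?F 0 = ?phi 0 * ?F (-1)" using signed_val_left[of ?p n] by simp
    show "?F (int d) = 0" unfolding end_pt by (rule signed_val_right)
  qed (use Suc.prems in \<open>auto simp: algebra_simps\<close>)
  finally show ?case by simp
qed

text \<open>
  The right end of the interval in the coordinate $y = c + 1/2$, since $d + 1/2 = p/2$.
\<close>

definition half_p :: poly_pc where "half_p = const_pc (1/2) * var_p"
definition mid_c :: poly_pc where "mid_c = var_c + const_pc (1/2)"

definition plain_coeff_pc :: "nat \<Rightarrow> poly_pc" where
  "plain_coeff_pc = deconv (\<lambda>j. const_pc (1 / of_nat (2 * j + 1)) * central_even j half_p)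
                           (\<lambda>j. - central_even j half_p)"

definition signed_coeff_pc :: "nat \<Rightarrow> poly_pc" where
  "signed_coeff_pc = deconv (\<lambda>j. central_even j half_p) (\<lambda>j. central_odd j half_p)"

definition plain_pc :: "nat \<Rightarrow> poly_pc" where
  "plain_pc n = (- var_p) ^ n *
     ((\<Sum>j\<le>n. plain_coeff_pc (n - j) * central_odd j mid_c) + half_p * central_even n mid_c)"

definition signed_pc :: "nat \<Rightarrow> poly_pc" where
  "signed_pc n = (- 1) ^ n *
     ((\<Sum>j\<le>n. signed_coeff_pc (n - j) * central_even j mid_c) - central_odd n mid_c)"

lemma eval_plain_pc: "eval_pc (plain_pc n) p c = plain_val p n (c + 1/2)"
  by (simp add: plain_pc_def plain_val_def ladder_def plain_coeff_pc_def plain_coeff_def eval_pc_deconv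
      eval_central_even eval_central_odd half_p_def mid_c_def)

lemma eval_signed_pc: "eval_pc (signed_pc n) p c = signed_val p n (c + 1/2)"
  by (simp add: signed_pc_def signed_val_def ladder_def signed_coeff_pc_def signed_coeff_def eval_pc_deconv
      eval_central_even eval_central_odd half_p_def mid_c_def)

section \<open>Total degree and terms of the two highest degrees\<close>

lemma const_pc_ring:
  "const_pc (a + b) = const_pc a + const_pc b" "const_pc (a - b) = const_pc a - const_pc b"
  "const_pc (- a) = - const_pc a" "const_pc (a * b) = const_pc a * const_pc b"
  "const_pc 0 = 0" "const_pc 1 = 1"
  by (simp_all add: const_pc_def pCons_one)

lemma const_pc_power: "const_pc (a ^ n) = const_pc a ^ n"
  by (induction n) (simp_all add: const_pc_ring)

lemmas const_pc_simps = const_pc_ring const_pc_power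

lemma const_pc_sum: "const_pc (sum f A) = (\<Sum>x\<in>A. const_pc (f x))"
  by (induction A rule: infinite_finite_induct) (simp_all add: const_pc_simps)

text \<open>
  The bound is an integer, so that subtracting \<open>2\<close> from a degree below \<open>2\<close> gives a negative bound,
  which forces the polynomial to be zero.
\<close>

definition deg_le :: "poly_pc \<Rightarrow> int \<Rightarrow> bool" where
  "deg_le P n \<longleftrightarrow> (\<forall>i j. coeff (coeff P i) j \<noteq> 0 \<longrightarrow> int (i + j) \<le> n)"

lemma deg_leD: "deg_le P n \<Longrightarrow> coeff (coeff P i) j \<noteq> 0 \<Longrightarrow> int (i + j) \<le> n"
  unfolding deg_le_def by blast

lemma deg_leD_nat: "deg_le P (int n) \<Longrightarrow> coeff (coeff P i) j \<noteq> 0 \<Longrightarrow> i + j \<le> n"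
  using deg_leD by fastforce

lemma deg_le_mono: "deg_le P m \<Longrightarrow> m \<le> n \<Longrightarrow> deg_le P n"
  unfolding deg_le_def by (meson order_trans)

lemma deg_le_zero: "deg_le 0 n"
  by (simp add: deg_le_def)

lemma deg_le_add: "deg_le P n \<Longrightarrow> deg_le Q n \<Longrightarrow> deg_le (P + Q) n"
  unfolding deg_le_def by (metis coeff_add add.right_neutral)

lemma deg_le_uminus: "deg_le P n \<Longrightarrow> deg_le (- P) n"
  by (simp add: deg_le_def)

lemma deg_le_diff: "deg_le P n \<Longrightarrow> deg_le Q n \<Longrightarrow> deg_le (P - Q) n"
  using deg_le_add[of P n "- Q"] deg_le_uminus by simp

lemma deg_le_sum: "(\<And>x. x \<in> A \<Longrightarrow> deg_le (f x) n) \<Longrightarrow> deg_le (sum f A) n"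
  by (induction A rule: infinite_finite_induct) (simp_all add: deg_le_zero deg_le_add)

lemma deg_le_mult:
  assumes "deg_le P m" "deg_le Q n"
  shows "deg_le (P * Q) (m + n)"
  unfolding deg_le_def
proof (intro allI impI)
  fix i j assume "coeff (coeff (P * Q) i) j \<noteq> 0"
  then have "(\<Sum>a\<le>i. \<Sum>b\<le>j. coeff (coeff P a) b * coeff (coeff Q (i - a)) (j - b)) \<noteq> 0"
    by (simp add: coeff_mult coeff_sum)
  then obtain a where a: "a \<le> i" "(\<Sum>b\<le>j. coeff (coeff P a) b * coeff (coeff Q (i - a)) (j - b)) \<noteq> 0"
    by (meson atMost_iff sum.neutral)
  then obtain b where b: "b \<le> j" "coeff (coeff P a) b * coeff (coeff Q (i - a)) (j - b) \<noteq> 0"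
    by (meson atMost_iff sum.neutral)
  then have "int (a + b) \<le> m" "int ((i - a) + (j - b)) \<le> n"
    using deg_leD[OF assms(1), of a b] deg_leD[OF assms(2), of "i - a" "j - b"] by simp_all
  then show "int (i + j) \<le> m + n" using a(1) b(1) by linarith
qed

lemma deg_le_const: "deg_le (const_pc q) 0"
  by (auto simp: deg_le_def const_pc_def coeff_pCons split: nat.splits)

lemma deg_le_one: "deg_le 1 0"
  using deg_le_const[of 1] by (simp add: const_pc_simps)

lemma deg_le_var_p: "deg_le var_p 1"
  by (auto simp: deg_le_def var_p_def coeff_pCons split: nat.splits)

lemma deg_le_var_c: "deg_le var_c 1"
  by (auto simp: deg_le_def var_c_def coeff_pCons split: nat.splits)

lemma deg_le_power: "deg_le P m \<Longrightarrow> deg_le (P ^ n) (int n * m)"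
proof (induction n)
  case (Suc n)
  then show ?case using deg_le_mult[of P m "P ^ n" "int n * m"] by (simp add: algebra_simps)
qed (simp add: deg_le_one)

lemma deg_le_half_p: "deg_le half_p 1"
  unfolding half_p_def using deg_le_mult[OF deg_le_const deg_le_var_p] by simp

lemma deg_le_mid_c: "deg_le mid_c 1"
  unfolding mid_c_def by (intro deg_le_add deg_le_var_c deg_le_mono[OF deg_le_const]) simp

lemma total_deg_le: "deg_le P (int n) \<Longrightarrow> total_deg P \<le> n"
proof (cases "P = 0")
  case False
  assume P: "deg_le P (int n)"
  let ?S = "{i + j | i j. coeff (coeff P i) j \<noteq> 0}"
  have S: "?S \<subseteq> {..n}" using deg_leD_nat[OF P] by auto
  moreover have "?S \<noteq> {}"
    using leading_coeff_neq_0[OF False] leading_coeff_neq_0[of "lead_coeff P"] by blast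
  ultimately have "Max ?S \<le> n" using finite_subset[OF S] by (subst Max_le_iff) auto
  then show ?thesis using False by (simp add: total_deg_def)
qed (simp add: total_deg_def)

lemma total_deg_eq:
  assumes P: "deg_le P (int (i + j))" and nz: "coeff (coeff P i) j \<noteq> 0"
  shows "total_deg P = i + j"
proof (rule antisym)
  let ?S = "{i + j | i j. coeff (coeff P i) j \<noteq> 0}"
  have S: "?S \<subseteq> {..i + j}" using deg_leD_nat[OF P] by auto
  have "i + j \<le> Max ?S" using nz finite_subset[OF S] by (intro Max_ge) auto
  then show "i + j \<le> total_deg P" using nz by (auto simp: total_deg_def)
qed (rule total_deg_le[OF P])

text \<open>
  Both polynomials have the same terms of degree \<open>m\<close> and \<open>m - 1\<close> and none of higher degree.  Two
  degrees come for free when working with $y = c + 1/2$: the central factorials are even or odd, so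
  a single monomial serves as \<open>T\<close>.
\<close>

definition leads :: "poly_pc \<Rightarrow> poly_pc \<Rightarrow> int \<Rightarrow> bool" where
  "leads P T m \<longleftrightarrow> deg_le T m \<and> deg_le (P - T) (m - 2)"

lemma leads_deg_le: "leads P T m \<Longrightarrow> deg_le P m"
  using deg_le_add[of "P - T" m T] deg_le_mono[of "P - T" "m - 2" m] by (simp add: leads_def)

lemma leads_refl: "deg_le P m \<Longrightarrow> leads P P m"
  by (simp add: leads_def deg_le_zero)

lemma leads_trans: "leads P Q m \<Longrightarrow> leads Q T m \<Longrightarrow> leads P T m"
  using deg_le_add[of "P - Q" "m - 2" "Q - T"] by (simp add: leads_def)

lemma leads_add: "leads P T m \<Longrightarrow> leads P' T' m \<Longrightarrow> leads (P + P') (T + T') m"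
  using deg_le_add[of "P - T" "m - 2" "P' - T'"] deg_le_add[of T m T']
  by (simp add: leads_def algebra_simps)

lemma leads_uminus: "leads P T m \<Longrightarrow> leads (- P) (- T) m"
  using deg_le_uminus[of "P - T" "m - 2"] deg_le_uminus[of T m] by (simp add: leads_def)

lemma leads_diff: "leads P T m \<Longrightarrow> leads P' T' m \<Longrightarrow> leads (P - P') (T - T') m"
  using leads_add[of P T m "- P'" "- T'"] leads_uminus by simp

lemma leads_sum: "(\<And>x. x \<in> A \<Longrightarrow> leads (f x) (t x) m) \<Longrightarrow> leads (sum f A) (sum t A) m"
  by (induction A rule: infinite_finite_induct) (simp_all add: leads_add leads_refl deg_le_zero)

lemma leads_mult:
  assumes "leads P T m" "leads Q U n"
  shows "leads (P * Q) (T * U) (m + n)"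
proof -
  have "deg_le (P * (Q - U)) (m + (n - 2))" "deg_le ((P - T) * U) ((m - 2) + n)"
    using assms leads_deg_le[OF assms(1)] by (auto simp: leads_def intro!: deg_le_mult)
  then have "deg_le (P * (Q - U) + (P - T) * U) (m + n - 2)"
    by (intro deg_le_add) (simp_all add: algebra_simps)
  moreover have "P * (Q - U) + (P - T) * U = P * Q - T * U" by (simp add: algebra_simps)
  ultimately show ?thesis using assms by (simp add: leads_def deg_le_mult)
qed

lemma leads_const_mult: "leads P T m \<Longrightarrow> leads (const_pc q * P) (const_pc q * T) m"
  using leads_mult[OF leads_refl[OF deg_le_const], of P T m q] by simp

lemma leads_central_even:
  assumes "deg_le Y 1"
  shows "leads (central_even j Y) (const_pc (1 / fact (2 * j)) * Y ^ (2 * j)) (int (2 * j))"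
proof -
  have "leads (\<Prod>i<j. Y ^ 2 - const_pc (q i)) (Y ^ (2 * j)) (int (2 * j))" for q :: "nat \<Rightarrow> rat"
  proof (induction j)
    case (Suc j)
    have "leads (Y ^ 2 - const_pc (q j)) (Y ^ 2) 2"
      using deg_le_power[OF assms, of 2] by (simp add: leads_def deg_le_uminus deg_le_const)
    from leads_mult[OF Suc this] show ?case
      by (simp add: mult.commute power_add[symmetric] algebra_simps flip: power2_eq_square)
  qed (simp add: leads_refl deg_le_one)
  then show ?thesis unfolding central_even_def by (rule leads_const_mult)
qed

lemma leads_central_odd:
  assumes "deg_le Y 1"
  shows "leads (central_odd j Y) (const_pc (1 / fact (2 * j + 1)) * Y ^ (2 * j + 1)) (int (2 * j + 1))"
proof -
  have "leads (central_odd j Y)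
      (const_pc (1 / of_nat (2 * j + 1)) * (Y * (const_pc (1 / fact (2 * j)) * Y ^ (2 * j)))) (1 + int (2 * j))"
    unfolding central_odd_def mult.assoc
    by (intro leads_const_mult leads_mult leads_refl leads_central_even assms)
  also have "const_pc (1 / of_nat (2 * j + 1)) * (Y * (const_pc (1 / fact (2 * j)) * Y ^ (2 * j)))
     = const_pc (1 / of_nat (2 * j + 1) * (1 / fact (2 * j))) * Y ^ (2 * j + 1)"
    unfolding const_pc_simps by (simp add: mult_ac)
  finally show ?thesis by simp
qed

text \<open>
  Going back from $y = c + 1/2$ to $c$ is the only step that produces terms of degree one below the
  top; they come from the second term of the binomial expansion.
\<close>

lemma leads_mid_c_power:
  "leads (mid_c ^ Suc m) (var_c ^ Suc m + const_pc (of_nat (Suc m) / 2) * var_c ^ m) (int (Suc m))"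
proof (induction m)
  case 0
  show ?case using deg_le_mid_c by (simp add: mid_c_def leads_refl)
next
  case (Suc m)
  let ?t = "var_c ^ Suc m + const_pc (of_nat (Suc m) / 2) * var_c ^ m"
  \<comment> \<open>The term of degree \<open>m\<close> that the new factor $c + 1/2$ produces and that is dropped.\<close>
  let ?r = "const_pc (of_nat (Suc m) / 2) * var_c ^ m * const_pc (1/2)"
  have "leads (mid_c ^ Suc m * mid_c) (?t * mid_c) (int (Suc m) + 1)"
    by (intro leads_mult Suc leads_refl deg_le_mid_c)
  moreover have "leads (?t * mid_c) (?t * mid_c - ?r) (int (Suc m) + 1)"
  proof -
    have r: "deg_le ?r (int m)"
      using deg_le_mult[OF deg_le_mult[OF deg_le_const deg_le_power[OF deg_le_var_c]] deg_le_const, of _ m]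
      by simp
    moreover have "deg_le (?t * mid_c) (int (Suc m) + 1)"
      using Suc by (intro deg_le_mult deg_le_mid_c) (simp add: leads_def)
    moreover have "deg_le ?r (int (Suc m) + 1)" using deg_le_mono[OF r] by simp
    ultimately show ?thesis by (simp add: leads_def deg_le_diff)
  qed
  moreover have "?t * mid_c - ?r = var_c ^ Suc (Suc m) + const_pc (of_nat (Suc (Suc m)) / 2) * var_c ^ Suc m"
  proof -
    have e: "of_nat (Suc (Suc m)) / 2 = of_nat (Suc m) / 2 + (1/2 :: rat)" by (simp add: field_simps)
    show ?thesis unfolding e const_pc_simps mid_c_def by (simp add: algebra_simps)
  qed
  ultimately show ?case using leads_trans by (simp add: mult.commute add.commute)
qed

section \<open>Bernoulli numbers\<close>

abbreviation bern :: "nat \<Rightarrow> rat" where "bern n \<equiv> bernoulli n / fact n"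

lemma sum_pairs: "sum f {..<2 * n} = (\<Sum>j<n. f (2 * j) + f (2 * j + 1 :: nat))"
  for f :: "nat \<Rightarrow> 'a::comm_monoid_add"
  by (induction n) (simp_all add: add.assoc)

text \<open>
  Multiplying $\frac{t}{e^t-1}(e^t-1) = t$ by $e^{-t/2}$ gives
  $\frac{t}{e^t-1}\cdot 2\sinh\frac t2 = t\,e^{-t/2}$.  Since the hyperbolic sine is odd, the
  coefficient of $t^{2n+1}$ involves only Bernoulli numbers of even index.
\<close>

lemma bernoulli_even_convolution:
  "(\<Sum>j\<le>n. bern (2 * (n - j)) * ((1/4) ^ j / fact (2 * j + 1))) = (1/4) ^ n / fact (2 * n)"
proof -
  let ?A = "Abs_fps bern" and ?h = "fps_exp (1/2 :: rat)" and ?h' = "fps_exp (- (1/2) :: rat)"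
  have 1: "(fps_exp 1 - 1) * ?h' = ?h - ?h'"
    using fps_exp_add_mult[of 1 "- (1/2) :: rat"] by (simp add: algebra_simps)
  have coeff: "fps_nth (?h - ?h') (2 * j + 1) = (1/4) ^ j / fact (2 * j + 1)" for j
  proof -
    have "(1/2) ^ (2 * j + 1) = ((1/4) ^ j / 2 :: rat)"
      "(- (1/2)) ^ (2 * j + 1) = (- ((1/4) ^ j / 2) :: rat)"
      by (simp_all add: power_mult power2_eq_square)
    moreover have "x / 2 / f - - (x / 2) / f = x / f" for x f :: rat
      by (simp flip: diff_divide_distrib)
    ultimately show ?thesis
      by (simp only: fps_sub_nth fps_exp_nth of_nat_fact)
  qed
  have "(?h - ?h') * ?A = fps_X * ?h'"
    unfolding 1[symmetric] bernoulli_fps[symmetric] by (simp only: mult_ac)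
  then have "fps_nth ((?h - ?h') * ?A) (2 * n + 1) = (- (1/2)) ^ (2 * n) / fact (2 * n)"
    by simp
  also have "(- (1/2)) ^ (2 * n) = ((1/4) ^ n :: rat)"
    by (simp add: power_mult power2_eq_square)
  also have "fps_nth ((?h - ?h') * ?A) (2 * n + 1) =
      (\<Sum>i<2 * Suc n. fps_nth (?h - ?h') i * bern (2 * n + 1 - i))"
    unfolding fps_mult_nth by (intro sum.cong) auto
  also have "\<dots> = (\<Sum>j<Suc n. fps_nth (?h - ?h') (2 * j + 1) * bern (2 * (n - j)))"
    unfolding sum_pairs by (intro sum.cong refl) (simp add: diff_mult_distrib2)
  also have "\<dots> = (\<Sum>j\<le>n. bern (2 * (n - j)) * ((1/4) ^ j / fact (2 * j + 1)))"
    unfolding lessThan_Suc_atMost coeff by (simp only: mult.commute)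
  finally show ?thesis .
qed

lemma bernoulli_0: "bernoulli 0 = 1"
  using bernoulli_even_convolution[of 0] by simp

text \<open>
  The generating function $A(t) = t/(e^t-1)$ satisfies $A(-t) = A(t) + t$; so all odd
  Bernoulli numbers but the first vanish.
\<close>

lemma bernoulli_reflect:
  "(-1) ^ n * bern n = bern n + (if n = 1 then 1 else 0)"
proof -
  let ?A = "Abs_fps bern" and ?M = "Abs_fps (\<lambda>n. (-1) ^ n * bern n)" and ?e = "fps_exp 1 :: rat fps"
  have "?M * (fps_exp (-1) - 1) = - fps_X"
  proof (rule fps_ext)
    fix n
    have "fps_nth (?M * (fps_exp (-1) - 1)) n = (-1) ^ n * fps_nth (?A * (?e - 1)) n"
      unfolding fps_mult_nth sum_distrib_left
    proof (intro sum.cong refl)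
      fix i assume "i \<in> {0..n}"
      then have "(-1) ^ n = (-1) ^ i * ((-1) ^ (n - i) :: rat)"
        by (simp flip: power_add)
      then show "fps_nth ?M i * fps_nth (fps_exp (-1) - 1) (n - i)
          = (-1) ^ n * (fps_nth ?A i * fps_nth (?e - 1) (n - i))"
        by simp
    qed
    then show "fps_nth (?M * (fps_exp (-1) - 1)) n = fps_nth (- fps_X) n"
      by (simp add: bernoulli_fps fps_X_def)
  qed
  then have "?M * ((fps_exp (-1) - 1) * ?e) = - fps_X * ?e"
    by (simp only: mult.assoc[symmetric])
  moreover have "(fps_exp (-1) - 1) * ?e = 1 - ?e"
    using fps_exp_add_mult[of "-1" "1 :: rat"] by (simp add: algebra_simps)
  ultimately have "?M * (1 - ?e) = - fps_X * ?e"
    by (simp only:)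
  moreover have "?M * (?e - 1) = - (?M * (1 - ?e))"
    by (simp only: right_diff_distrib minus_diff_eq)
  ultimately have "?M * (?e - 1) = fps_X * ?e"
    by simp
  also have "\<dots> = (?A + fps_X) * (?e - 1)"
    unfolding distrib_right bernoulli_fps by (simp add: algebra_simps)
  finally have "?M = ?A + fps_X" by simp
  then have "fps_nth ?M n = fps_nth (?A + fps_X) n" by simp
  then show ?thesis by (simp add: fps_X_def)
qed

lemma bernoulli_1: "bernoulli 1 = - (1/2)"
  using bernoulli_reflect[of 1] by simp

lemma bernoulli_odd: "j > 0 \<Longrightarrow> bernoulli (Suc (2 * j)) = 0"
  using bernoulli_reflect[of "Suc (2 * j)"] by simp

section \<open>Leading terms of the counts\<close>

lemma half_p_power: "half_p ^ (2 * j) = const_pc ((1/4) ^ j) * var_p ^ (2 * j)"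
  unfolding half_p_def const_pc_simps power_mult_distrib power_mult
  by (simp add: power2_eq_square flip: const_pc_simps(4))

lemma leads_central_even_half_p:
  "leads (central_even j half_p) (const_pc ((1/4) ^ j / fact (2 * j)) * var_p ^ (2 * j)) (int (2 * j))"
proof -
  have "const_pc ((1/4) ^ j / fact (2 * j)) = const_pc (1 / fact (2 * j)) * const_pc ((1/4) ^ j)"
    by (simp flip: const_pc_simps(4))
  then show ?thesis
    using leads_central_even[OF deg_le_half_p, of j] unfolding half_p_power by (simp add: mult.assoc)
qed

text \<open>
  To top order the recursion for the coefficients is \<open>bernoulli_even_convolution\<close> scaled by
  $p^{2n}$.
\<close>

lemma leads_plain_coeff:
  "leads (plain_coeff_pc n) (const_pc (- bern (2 * n)) * var_p ^ (2 * n)) (int (2 * n))"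
proof (induction n rule: less_induct)
  case (less n)
  let ?u = "\<lambda>j. const_pc (1 / of_nat (2 * j + 1)) * central_even j half_p"
  let ?q = "\<lambda>j. (1/4) ^ j / fact (2 * j + 1) :: rat"
  have summand: "leads (plain_coeff_pc (n - j) * ?u j)
      (const_pc (- bern (2 * (n - j)) * ?q j) * var_p ^ (2 * n)) (int (2 * n))" if "j \<in> {1..n}" for j
  proof -
    have "leads (plain_coeff_pc (n - j) * ?u j)
      ((const_pc (- bern (2 * (n - j))) * var_p ^ (2 * (n - j))) *
       (const_pc (1 / of_nat (2 * j + 1)) * (const_pc ((1/4) ^ j / fact (2 * j)) * var_p ^ (2 * j))))
      (int (2 * (n - j)) + int (2 * j))"
      using that by (intro leads_mult less leads_const_mult leads_central_even_half_p) auto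
    also have "int (2 * (n - j)) + int (2 * j) = int (2 * n)" using that by auto
    also have "(const_pc (- bern (2 * (n - j))) * var_p ^ (2 * (n - j))) *
       (const_pc (1 / of_nat (2 * j + 1)) * (const_pc ((1/4) ^ j / fact (2 * j)) * var_p ^ (2 * j)))
       = const_pc (- bern (2 * (n - j)) * (1 / of_nat (2 * j + 1) * ((1/4) ^ j / fact (2 * j)))) *
         var_p ^ (2 * (n - j) + 2 * j)"
      unfolding const_pc_simps power_add by (simp only: mult_ac)
    also have "1 / of_nat (2 * j + 1) * ((1/4) ^ j / fact (2 * j)) = ?q j" by simp
    also have "2 * (n - j) + 2 * j = 2 * n" using that by auto
    finally show ?thesis .
  qed
  have "leads (plain_coeff_pc n)
      (- (const_pc ((1/4) ^ n / fact (2 * n)) * var_p ^ (2 * n)) -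
        (\<Sum>j=1..n. const_pc (- bern (2 * (n - j)) * ?q j) * var_p ^ (2 * n))) (int (2 * n))"
    unfolding plain_coeff_pc_def
    by (subst deconv.simps, unfold plain_coeff_pc_def[symmetric])
      (intro leads_diff leads_uminus leads_central_even_half_p leads_sum summand)
  also have "- (const_pc ((1/4) ^ n / fact (2 * n)) * var_p ^ (2 * n)) -
        (\<Sum>j=1..n. const_pc (- bern (2 * (n - j)) * ?q j) * var_p ^ (2 * n))
     = const_pc (- ((1/4) ^ n / fact (2 * n)) - (\<Sum>j=1..n. - bern (2 * (n - j)) * ?q j)) * var_p ^ (2 * n)"
    unfolding const_pc_simps(2,3) const_pc_sum by (simp only: left_diff_distrib sum_distrib_right mult_minus_left)
  also have "- ((1/4) ^ n / fact (2 * n)) - (\<Sum>j=1..n. - bern (2 * (n - j)) * ?q j) = - bern (2 * n)"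
    unfolding bernoulli_even_convolution[of n, symmetric]
    by (simp add: atMost_atLeast0 sum.atLeast_Suc_atMost sum_negf)
  finally show ?case .
qed

text \<open>
  The terms of the two highest degrees of $(c + 1/2)^{m+1}/(m+1)!$, in the form in which they occur in the
  leading terms.
\<close>

definition shifted_power :: "nat \<Rightarrow> poly_pc" where
  "shifted_power m = const_pc (1/2) *
     (const_pc (1 / fact m) * var_c ^ m * (1 + const_pc (2 / of_nat (m + 1)) * var_c))"

lemma leads_shifted_power:
  "leads (const_pc (1 / fact (m + 1)) * mid_c ^ (m + 1)) (shifted_power m) (int (m + 1))"
proof -
  have f: "1 / fact (m + 1) * (of_nat (m + 1) / 2) = (1/2) * (1 / fact m :: rat)"
    "1 / fact (m + 1) = (1/2) * (1 / fact m) * (2 / of_nat (m + 1) :: rat)"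
    by (simp_all add: divide_simps del: of_nat_Suc of_nat_add)
  have "const_pc (1 / fact (m + 1)) * (var_c ^ (m + 1) + const_pc (of_nat (m + 1) / 2) * var_c ^ m)
     = const_pc (1 / fact (m + 1)) * var_c ^ (m + 1)
       + const_pc (1 / fact (m + 1) * (of_nat (m + 1) / 2)) * var_c ^ m"
    unfolding const_pc_simps by (simp only: distrib_left mult_ac)
  also have "\<dots> = const_pc ((1/2) * (1 / fact m) * (2 / of_nat (m + 1))) * var_c ^ (m + 1)
       + const_pc ((1/2) * (1 / fact m)) * var_c ^ m"
    by (subst f(1), subst f(2)) (rule refl)
  also have "\<dots> = shifted_power m"
    unfolding const_pc_simps shifted_power_def by (simp add: algebra_simps)
  finally show ?thesis
    using leads_const_mult[OF leads_mid_c_power[of m], of "1 / fact (m + 1)"] by simp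
qed

lemma leads_neg_var_p_power_mult:
  "leads P T m \<Longrightarrow> leads ((- var_p) ^ n * P) ((- var_p) ^ n * T) (int n + m)"
  using deg_le_power[OF deg_le_uminus[OF deg_le_var_p], of n] by (auto intro!: leads_mult leads_refl)

text \<open>
  The relation \<open>leads\<close> passes through sums and products, factor by factor.  The summands run over the even Bernoulli
  indices $2(n-j)$; the last term is the one of index \<open>1\<close>.
\<close>

lemma leads_plain_pc:
  assumes "n \<ge> 1"
  shows "leads (plain_pc n)
    ((- var_p) ^ n * ((\<Sum>j\<le>n. const_pc (- bern (2 * (n - j))) * var_p ^ (2 * (n - j)) * shifted_power (2 * j))
      + half_p * shifted_power (2 * n - 1))) (int (3 * n + 1))"
proof -
  have odd: "leads (central_odd j mid_c) (shifted_power (2 * j)) (int (2 * j + 1))" for j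
    using leads_trans[OF leads_central_odd[OF deg_le_mid_c] leads_shifted_power] .
  have even: "leads (central_even n mid_c) (shifted_power (2 * n - 1)) (int (2 * n))"
    using leads_trans[OF leads_central_even[OF deg_le_mid_c, of n]] leads_shifted_power[of "2 * n - 1"] assms
    by simp
  have "leads (plain_coeff_pc (n - j) * central_odd j mid_c)
    (const_pc (- bern (2 * (n - j))) * var_p ^ (2 * (n - j)) * shifted_power (2 * j)) (int (2 * n + 1))"
    if "j \<le> n" for j
  proof -
    have "int (2 * (n - j)) + int (2 * j + 1) = int (2 * n + 1)" using that by auto
    from leads_mult[OF leads_plain_coeff odd, of "n - j" j, unfolded this] show ?thesis .
  qed
  moreover have "leads (half_p * central_even n mid_c) (half_p * shifted_power (2 * n - 1)) (int (2 * n + 1))"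
    using leads_mult[OF leads_refl[OF deg_le_half_p] even] by (simp add: add.commute)
  ultimately have "leads (plain_pc n)
    ((- var_p) ^ n * ((\<Sum>j\<le>n. const_pc (- bern (2 * (n - j))) * var_p ^ (2 * (n - j)) * shifted_power (2 * j))
      + half_p * shifted_power (2 * n - 1))) (int n + int (2 * n + 1))"
    unfolding plain_pc_def by (intro leads_neg_var_p_power_mult leads_add leads_sum) auto
  also have "int n + int (2 * n + 1) = int (3 * n + 1)" by simp
  finally show ?thesis .
qed

lemma leading_terms_altdef:
  "const_pc 2 * leading_terms (Suc n) =
     (- var_p) ^ n * (\<Sum>k\<le>2 * n. const_pc (- bern k) * var_p ^ k * shifted_power (2 * n - k))"
proof -
  have sgn: "const_pc 2 * const_pc ((-1) ^ Suc n / 4) = (-1) ^ n * (- 1) * const_pc (1/2)"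
  proof -
    have "2 * ((-1) ^ Suc n / 4) = (-1) ^ n * (- 1) * (1/2 :: rat)" by simp
    then have "const_pc (2 * ((-1) ^ Suc n / 4)) = const_pc ((-1) ^ n * (- 1) * (1/2))" by (rule arg_cong)
    then show ?thesis by (simp only: const_pc_simps)
  qed
  have pw: "(- var_p) ^ n = (-1) ^ n * var_p ^ n" by (rule power_minus)
  show ?thesis
    unfolding leading_terms_def mult.assoc[symmetric] sgn pw sum_distrib_left sum_distrib_right
      shifted_power_def
  proof (intro sum.cong, goal_cases)
    case (2 k)
    then have "2 * Suc n - 2 - k = 2 * n - k" "2 * Suc n - 1 - k = 2 * n - k + 1" by auto
    then show ?case by (simp add: const_pc_simps(3) power_add mult_ac)
  qed auto
qed

text \<open>
  The terms with odd index above \<open>1\<close> vanish, and the one of index \<open>1\<close> has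
  $-B_1\,p = p/2$.
\<close>

lemma plain_top_eq:
  assumes "n \<ge> 1"
  shows "(\<Sum>j\<le>n. const_pc (- bern (2 * (n - j))) * var_p ^ (2 * (n - j)) * shifted_power (2 * j))
      + half_p * shifted_power (2 * n - 1) = (\<Sum>k\<le>2 * n. const_pc (- bern k) * var_p ^ k * shifted_power (2 * n - k))"
proof -
  let ?f = "\<lambda>k. const_pc (- bern k) * var_p ^ k * shifted_power (2 * n - k)"
  have "(\<Sum>k\<le>2 * n. ?f k) = sum ?f {..<2 * n} + ?f (2 * n)"
    by (simp flip: lessThan_Suc_atMost)
  also have "\<dots> = (\<Sum>j\<le>n. ?f (2 * j)) + (\<Sum>j<n. ?f (2 * j + 1))"
    unfolding sum_pairs sum.distrib by (simp flip: lessThan_Suc_atMost add: add_ac)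
  also have "(\<Sum>j<n. ?f (2 * j + 1)) = (\<Sum>j<n. if j = 0 then half_p * shifted_power (2 * n - 1) else 0)"
    by (intro sum.cong refl)
      (auto simp: bernoulli_odd const_pc_simps half_p_def bernoulli_1[simplified])
  also have "\<dots> = half_p * shifted_power (2 * n - 1)" using assms by (simp add: sum.delta)
  also have "(\<Sum>j\<le>n. ?f (2 * j)) =
     (\<Sum>j\<le>n. const_pc (- bern (2 * (n - j))) * var_p ^ (2 * (n - j)) * shifted_power (2 * j))"
    by (rule sum.reindex_bij_witness[where i = "\<lambda>j. n - j" and j = "\<lambda>j. n - j"])
      (auto simp: diff_mult_distrib2)
  finally show ?thesis by simp
qed

lemma leads_plain_pc_leading_terms:
  assumes "n \<ge> 1"
  shows "leads (const_pc (1/2) * plain_pc n) (leading_terms (Suc n)) (int (3 * n + 1))"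
proof -
  have "const_pc (1/2) * const_pc 2 = 1"
    by (simp add: const_pc_simps(6) flip: const_pc_simps(4))
  then have "const_pc (1/2) * (const_pc 2 * leading_terms (Suc n)) = leading_terms (Suc n)"
    by (simp only: mult.assoc[symmetric] mult_1_left)
  with leads_const_mult[OF leads_plain_pc[OF assms], of "1/2"] show ?thesis
    unfolding plain_top_eq[OF assms] leading_terms_altdef[symmetric] by (simp only:)
qed

lemma deg_le_signed_coeff: "deg_le (signed_coeff_pc n) (int (2 * n + 1))"
proof (induction n rule: less_induct)
  case (less n)
  have "deg_le (signed_coeff_pc (n - j) * central_even j half_p) (int (2 * n + 1))" if "j \<in> {1..n}" for j
  proof -
    have "deg_le (signed_coeff_pc (n - j) * central_even j half_p) (int (2 * (n - j) + 1) + int (2 * j))"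
      using that leads_deg_le[OF leads_central_even[OF deg_le_half_p]] by (intro deg_le_mult less) auto
    also have "int (2 * (n - j) + 1) + int (2 * j) = int (2 * n + 1)" using that by auto
    finally show ?thesis .
  qed
  then show ?case
    unfolding signed_coeff_pc_def
    by (subst deconv.simps, unfold signed_coeff_pc_def[symmetric])
      (intro deg_le_diff deg_le_sum leads_deg_le[OF leads_central_odd[OF deg_le_half_p]])
qed

text \<open>
  No factor \<open>p\<close> is gained in a step of the signed recursion, so its degree grows by \<open>2\<close> instead of \<open>3\<close>.
\<close>

lemma deg_le_signed_pc: "deg_le (signed_pc n) (int (2 * n + 1))"
proof -
  have "deg_le (signed_coeff_pc (n - j) * central_even j mid_c) (int (2 * n + 1))" if "j \<le> n" for j
  proof -
    have "deg_le (signed_coeff_pc (n - j) * central_even j mid_c) (int (2 * (n - j) + 1) + int (2 * j))"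
      by (intro deg_le_mult deg_le_signed_coeff leads_deg_le[OF leads_central_even[OF deg_le_mid_c]])
    also have "int (2 * (n - j) + 1) + int (2 * j) = int (2 * n + 1)" using that by auto
    finally show ?thesis .
  qed
  then have "deg_le ((\<Sum>j\<le>n. signed_coeff_pc (n - j) * central_even j mid_c) - central_odd n mid_c) (int (2 * n + 1))"
    by (intro deg_le_diff deg_le_sum leads_deg_le[OF leads_central_odd[OF deg_le_mid_c]]) auto
  moreover have "deg_le ((-1) ^ n) 0"
    using deg_le_power[OF deg_le_uminus[OF deg_le_one], of n] by simp
  ultimately show ?thesis
    unfolding signed_pc_def using deg_le_mult[of "(-1) ^ n" 0] by simp
qed

lemma coeff_const_pc_mult: "coeff (coeff (const_pc q * P) i) j = q * coeff (coeff P i) j"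
  by (simp add: const_pc_def)

lemma coeff_mult_var_p_power: "coeff (P * var_p ^ m) i = (if i < m then 0 else coeff P (i - m))"
proof -
  have "var_p ^ m = monom 1 m" by (simp add: var_p_def monom_altdef)
  then show ?thesis by (simp add: mult.commute[of P] coeff_monom_mult)
qed

lemma coeff_coeff_linear_power:
  "coeff (coeff (const_pc a * (const_pc b * var_c ^ m) * (1 + const_pc e * var_c)) 0) (Suc m) = a * b * e"
proof -
  have "var_c ^ m = [:monom 1 m:]" for m
    unfolding var_c_def by (induction m) (simp_all add: monom_Suc pCons_one)
  note c = this
  have "const_pc a * (const_pc b * var_c ^ m) * (1 + const_pc e * var_c)
     = const_pc (a * b) * (var_c ^ m) + const_pc (a * b * e) * var_c ^ Suc m"
    unfolding const_pc_simps by (simp add: algebra_simps)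
  then show ?thesis by (simp only: c coeff_add coeff_const_pc_mult) simp
qed

text \<open>
  The monomial $p^n c^{2n+1}$ arises only from the summand with \<open>k = 0\<close>.
\<close>

lemma top_coeff_leading_terms: "coeff (coeff (leading_terms (Suc n)) n) (2 * n + 1) \<noteq> 0"
proof -
  let ?f = "\<lambda>k. const_pc (bern k) * (const_pc (1 / fact (2 * n - k)) * var_c ^ (2 * n - k)) *
        (1 + const_pc (2 / of_nat (2 * n + 1 - k)) * var_c)"
  have L: "leading_terms (Suc n) = const_pc ((-1) ^ Suc n / 4) * (\<Sum>k=0..2 * n. ?f k * var_p ^ (n + k))"
    unfolding leading_terms_def by simp
  have "coeff (coeff (\<Sum>k=0..2 * n. ?f k * var_p ^ (n + k)) n) (2 * n + 1)
    = (\<Sum>k=0..2 * n. if k = 0 then coeff (coeff (?f 0) 0) (2 * n + 1) else 0)"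
    unfolding coeff_sum coeff_mult_var_p_power by (intro sum.cong) auto
  also have "\<dots> = coeff (coeff (?f 0) 0) (2 * n + 1)" by simp
  also have "\<dots> = bern 0 * (1 / fact (2 * n)) * (2 / of_nat (2 * n + 1))"
    using coeff_coeff_linear_power[of "bern 0" "1 / fact (2 * n)" "2 * n" "2 / of_nat (2 * n + 1)"] by simp
  finally have "coeff (coeff (leading_terms (Suc n)) n) (2 * n + 1)
      = (-1) ^ Suc n / 4 * (bern 0 * (1 / fact (2 * n)) * (2 / of_nat (2 * n + 1)))"
    unfolding L coeff_const_pc_mult by simp
  then show ?thesis by (simp add: bernoulli_0 of_nat_Suc[symmetric] del: of_nat_Suc)
qed

section \<open>Even and odd colorings\<close>

lemma num_colorings_eq:
  fixes g d c :: nat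
  defines "N \<equiv> weighted_count (\<lambda>_. 1) g (Suc (2 * d)) c"
    and "D \<equiv> parity_sign (int c) * weighted_count parity_sign g (Suc (2 * d)) c"
  shows "of_nat (num_even_colorings g (Suc (2 * d)) c) = (N + D) / 2"
    and "of_nat (num_odd_colorings g (Suc (2 * d)) c) = (N - D) / 2"
proof -
  let ?L = "lollipop_colorings g (Suc (2 * d)) c" and ?s = "\<lambda>(a, l, k). parity_sign (int c + (\<Sum>i=1..g. a i))"
  have N: "N = (\<Sum>x\<in>?L. 1)" unfolding N_def weighted_count_def by (simp add: split_def)
  have D: "D = (\<Sum>x\<in>?L. ?s x)"
    unfolding D_def weighted_count_def by (simp add: sum_distrib_left split_def parity_sign_add)
  have card: "of_nat (card {x \<in> ?L. P x}) = (\<Sum>x\<in>?L. if P x then 1 else 0 :: rat)" for P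
    by (simp add: sum.If_cases finite_lollipop_colorings Int_def)
  have "of_nat (num_even_colorings g (Suc (2 * d)) c) = (\<Sum>x\<in>?L. (1 + ?s x) / 2)"
    unfolding num_even_colorings_def
    by (simp add: split_def card, intro sum.cong refl, auto simp: parity_sign_def)
  then show "of_nat (num_even_colorings g (Suc (2 * d)) c) = (N + D) / 2"
    unfolding N D by (simp add: sum.distrib sum_divide_distrib add_divide_distrib)
  have "of_nat (num_odd_colorings g (Suc (2 * d)) c) = (\<Sum>x\<in>?L. (1 - ?s x) / 2)"
    unfolding num_odd_colorings_def
    by (simp add: split_def card, intro sum.cong refl, auto simp: parity_sign_def)
  then show "of_nat (num_odd_colorings g (Suc (2 * d)) c) = (N - D) / 2"
    unfolding N D by (simp add: sum_subtractf sum_divide_distrib diff_divide_distrib)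
qed

text \<open>
  The even and the odd count differ from half the total count by \<open>Q\<close>, which is plus or minus half the
  signed count.  Its degree is below the top for every \<open>n \<ge> 1\<close>, and at most \<open>3 * n - 1\<close> when
  \<open>n \<ge> 2\<close>.
\<close>

lemma degree_half_plain_pc_plus:
  assumes n: "n \<ge> 1" and Q: "deg_le Q (int (2 * n + 1))"
  shows "total_deg (const_pc (1/2) * plain_pc n + Q) = 3 * n + 1"
    and "n \<ge> 2 \<Longrightarrow> equiv_upto_deg (3 * n - 1) (const_pc (1/2) * plain_pc n + Q) (leading_terms (Suc n))"
proof -
  let ?P = "const_pc (1/2) * plain_pc n" and ?L = "leading_terms (Suc n)"
  have P: "deg_le ?L (int (3 * n + 1))" "deg_le (?P - ?L) (int (3 * n - 1))"
    using leads_plain_pc_leading_terms[OF n] n by (simp_all add: leads_def of_nat_diff)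
  have split: "?P + Q - ?L = (?P - ?L) + Q" by simp
  have low: "deg_le (?P + Q - ?L) (int (3 * n))"
    unfolding split by (intro deg_le_add deg_le_mono[OF P(2)] deg_le_mono[OF Q]) (use n in auto)
  have "coeff (coeff (?P + Q - ?L) n) (2 * n + 1) = 0"
  proof (rule ccontr)
    assume "coeff (coeff (?P + Q - ?L) n) (2 * n + 1) \<noteq> 0"
    from deg_leD_nat[OF low this] show False by simp
  qed
  then have "coeff (coeff (?P + Q) n) (2 * n + 1) \<noteq> 0"
    using top_coeff_leading_terms[of n] by simp
  moreover have "deg_le (?P + Q) (int (n + (2 * n + 1)))"
  proof -
    have "deg_le ((?P + Q - ?L) + ?L) (int (3 * n + 1))"
      by (intro deg_le_add P(1) deg_le_mono[OF low]) simp
    then show ?thesis by simp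
  qed
  ultimately show "total_deg (?P + Q) = 3 * n + 1"
    using total_deg_eq[of "?P + Q" n "2 * n + 1"] by simp
  assume n2: "n \<ge> 2"
  then have "deg_le (?P + Q - ?L) (int (3 * n - 1))"
    unfolding split by (intro deg_le_add P(2) deg_le_mono[OF Q]) auto
  then show "equiv_upto_deg (3 * n - 1) (?P + Q) ?L"
    unfolding equiv_upto_deg_def by (rule total_deg_le)
qed

theorem corollary2p9:
  fixes g :: nat
  assumes "g \<ge> 2"
  shows "\<exists>E Od :: poly_pc.
    (\<forall>p c :: nat. prime p \<and> p \<ge> 5 \<and> c \<le> (p - 3) div 2 \<longrightarrow>
       of_nat (num_even_colorings g p c) = eval_pc E (of_nat p) (of_nat c) \<and>
       of_nat (num_odd_colorings g p c) = eval_pc Od (of_nat p) (of_nat c)) \<and>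
    total_deg E = 3 * g - 2 \<and>
    total_deg Od = 3 * g - 2 \<and>
    (g \<ge> 3 \<longrightarrow>
       equiv_upto_deg (3 * g - 4) E (leading_terms g) \<and>
       equiv_upto_deg (3 * g - 4) Od (leading_terms g))"
proof -
  obtain n where g: "g = Suc n" and n: "n \<ge> 1"
    using assms by (cases g) auto
  let ?P = "const_pc (1/2) * plain_pc n" and ?A = "const_pc (1/2) * signed_pc n"
  have A: "deg_le ?A (int (2 * n + 1))"
    using deg_le_mult[OF deg_le_const deg_le_signed_pc] by simp
  have counts: "of_nat (num_even_colorings g p c) = eval_pc (?P + ?A) (of_nat p) (of_nat c) \<and>
       of_nat (num_odd_colorings g p c) = eval_pc (?P + - ?A) (of_nat p) (of_nat c)"
    if p: "prime p \<and> p \<ge> 5 \<and> c \<le> (p - 3) div 2" for p c :: nat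
  proof -
    have "odd p" using p by (intro prime_odd_nat) auto
    then obtain d where d: "p = Suc (2 * d)" by (auto elim: oddE)
    then have c: "c < d" using p by auto
    have "parity_sign (int c) * parity_sign (int c) = 1" by (simp add: parity_sign_def)
    then have "parity_sign (int c) * (parity_sign (int c) * x) = x" for x by (simp flip: mult.assoc)
    with num_colorings_eq[of g d c] plain_count_eq[OF c, of n] signed_count_eq[OF c, of n]
    show ?thesis unfolding d g by (simp add: eval_plain_pc eval_signed_pc add_divide_distrib diff_divide_distrib)
  qed
  have "3 * g - 2 = 3 * n + 1" "3 * g - 4 = 3 * n - 1" using n g by auto
  then have "total_deg (?P + ?A) = 3 * g - 2" "total_deg (?P + - ?A) = 3 * g - 2"
    "g \<ge> 3 \<longrightarrow> equiv_upto_deg (3 * g - 4) (?P + ?A) (leading_terms g) \<and>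
       equiv_upto_deg (3 * g - 4) (?P + - ?A) (leading_terms g)"
    using degree_half_plain_pc_plus[OF n A] degree_half_plain_pc_plus[OF n deg_le_uminus[OF A]] g
    by auto
  with counts show ?thesis
    by (intro exI[of _ "?P + ?A"] exI[of _ "?P + - ?A"] conjI allI) simp_all
qed

end
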